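(* Let $(L,[\cdot,\dots,\cdot],\varepsilon,\alpha,\beta)$ be an $n$-BiHom-Lie color algebra and $\gamma:L\to L$ a semi-morphism of $L$. Define a new multiplication $\{\cdot,\dots,\cdot\}:L\times\dots\times L\to L$ by $\{x_1,\dots,x_n\}=[x_1,\dots,\gamma(x_i),\dots,x_n]$ ($\gamma$ applied in position $i$). Then $(L,\{\cdot,\dots,\cdot\},\varepsilon,\alpha,\beta)$ is also an $n$-BiHom-Lie color algebra.
   Context: $\mathbb K$ is a field of characteristic different from $2$, $\Gamma$ is an abelian group (written additively) with identity element $e$, and all spaces are $\Gamma$-graded $\mathbb K$-vector spaces. A (skew-symmetric) bicharacter is a map $\varepsilon:\Gamma\times\Gamma\to\mathbb K^*$ with $\varepsilon(a,b)\varepsilon(b,a)=1$, $\varepsilon(a,b+c)=\varepsilon(a,b)\varepsilon(a,c)$, $\varepsilon(a+b,c)=\varepsilon(a,c)\varepsilon(b,c)$. Inside $\varepsilon$ and inside sums of arguments of $\varepsilon$, a homogeneous element stands for its degree. A (multi)linear map is even if it has degree zero (it preserves degree). An $n$-BiHom-Lie color algebra is a $5$-tuple $(L,[\cdot,\dots,\cdot],\varepsilon,\alpha,\beta)$ with $L$ a $\Gamma$-graded vector space, $[\cdot,\dots,\cdot]:L\times\dots\times L\to L$ an even $n$-linear map, $\varepsilon$ a bicharacter and $\alpha,\beta:L\to L$ even linear maps such that, for all homogeneous elements: (1) $\alpha\circ\beta=\beta\circ\alpha$; (2) $[\beta(x_1),\dots,\beta(x_k),\beta(x_{k+1}),\dots,\beta(x_{n-1}),\alpha(x_n)]=-\varepsilon(x_k,x_{k+1})[\beta(x_1),\dots,\beta(x_{k+1}),\beta(x_k),\dots,\beta(x_{n-1}),\alpha(x_n)]$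 for $k=1,\dots,n-2$, and $[\beta(x_1),\dots,\beta(x_{n-1}),\alpha(x_n)]=-\varepsilon(x_{n-1},x_n)[\beta(x_1),\dots,\beta(x_{n-2}),\beta(x_n),\alpha(x_{n-1})]$; (3) $[\beta^2(x_1),\dots,\beta^2(x_{n-1}),[\beta(y_1),\dots,\beta(y_{n-1}),\alpha(y_n)]]=\sum_{k=1}^n\varepsilon(X,Y_k)[\beta^2(y_1),\dots,\beta^2(y_{k-1}),[\beta(x_1),\dots,\beta(x_{n-1}),\alpha(y_k)],\beta^2(y_{k+1}),\dots,\beta^2(y_n)]$, where $X=\sum_{k=1}^{n-1}x_k$ and $Y_k=\sum_{l=1}^{k}y_{l-1}$ with $y_0=e$ (that is, $Y_k$ is the sum of the degrees of $y_1,\dots,y_{k-1}$). A semi-morphism of $(L,[\cdot,\dots,\cdot],\varepsilon,\alpha,\beta)$ is an even linear map $\gamma:L\to L$ such that $\gamma\alpha=\alpha\gamma$, $\gamma\beta=\beta\gamma$ and $\gamma[x_1,\dots,x_n]=[x_1,\dots,\gamma(x_i),\dots,x_n]$ for all $x_1,\dots,x_n\in L$ and every position $i\in\{1,\dots,n\}$. *)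

theory Defs
  imports Main "HOL-Computational_Algebra.Computational_Algebra"
begin

locale graded_vector_space = vector_space scale
  for scale :: "'k::field \<Rightarrow> 'v::ab_group_add \<Rightarrow> 'v" +
  fixes G :: "'g::ab_group_add \<Rightarrow> 'v set"
  assumes subspace_component: "subspace (G d)"
    and direct_sum: "\<exists>!f. (\<forall>d. f d \<in> G d) \<and> finite {d. f d \<noteq> 0} \<and> v = (\<Sum>d | f d \<noteq> 0. f d)"

text \<open>The list \<open>xs\<close> consists of homogeneous elements whose degrees are, in order, \<open>ds\<close>. The degrees
  are carried along explicitly because \<open>0\<close> is homogeneous of every degree.\<close>

definition homogeneous_list :: "('g \<Rightarrow> 'v set) \<Rightarrow> 'v list \<Rightarrow> 'g list \<Rightarrow> bool" where
  "homogeneous_list G xs ds \<longleftrightarrow> list_all2 (\<lambda>x d. x \<in> G d) xs ds"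

definition even_linear ::
  "('k::field \<Rightarrow> 'v::ab_group_add \<Rightarrow> 'v) \<Rightarrow> ('g \<Rightarrow> 'v set) \<Rightarrow> ('v \<Rightarrow> 'v) \<Rightarrow> bool" where
  "even_linear scale G f \<longleftrightarrow> Vector_Spaces.linear scale scale f \<and> (\<forall>d. \<forall>x\<in>G d. f x \<in> G d)"

text \<open>An \<open>n\<close>-ary operation is a function on lists, of which only the values on lists of length \<open>n\<close>
  matter. Positions are counted from \<open>0\<close>.\<close>

definition even_multilinear ::
  "nat \<Rightarrow> ('k::field \<Rightarrow> 'v::ab_group_add \<Rightarrow> 'v) \<Rightarrow> ('g::ab_group_add \<Rightarrow> 'v set) \<Rightarrow> ('v list \<Rightarrow> 'v) \<Rightarrow> bool"
  where
  "even_multilinear n scale G br \<longleftrightarrow>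
     (\<forall>xs i. length xs = n \<longrightarrow> i < n \<longrightarrow> Vector_Spaces.linear scale scale (\<lambda>v. br (xs[i := v]))) \<and>
     (\<forall>xs ds. length xs = n \<longrightarrow> homogeneous_list G xs ds \<longrightarrow> br xs \<in> G (sum_list ds))"

definition bicharacter :: "('g::ab_group_add \<Rightarrow> 'g \<Rightarrow> 'k::field) \<Rightarrow> bool" where
  "bicharacter \<epsilon> \<longleftrightarrow>
     (\<forall>a b. \<epsilon> a b \<noteq> 0) \<and>
     (\<forall>a b. \<epsilon> a b * \<epsilon> b a = 1) \<and>
     (\<forall>a b c. \<epsilon> a (b + c) = \<epsilon> a b * \<epsilon> a c) \<and>
     (\<forall>a b c. \<epsilon> (a + b) c = \<epsilon> a c * \<epsilon> b c)"

text \<open>\<open>(\<beta> x\<^sub>1, \<dots>, \<beta> x\<^sub>m\<^sub>-\<^sub>1, \<alpha> x\<^sub>m)\<close> for a nonempty list \<open>(x\<^sub>1, \<dots>, x\<^sub>m)\<close>.\<close>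

definition twist :: "('v \<Rightarrow> 'v) \<Rightarrow> ('v \<Rightarrow> 'v) \<Rightarrow> 'v list \<Rightarrow> 'v list" where
  "twist \<alpha> \<beta> xs = map \<beta> (butlast xs) @ [\<alpha> (last xs)]"

text \<open>In \<open>skew\<close>, the case \<open>Suc k = n - 1\<close> is the exchange of the last two arguments: there
  \<open>twist\<close> puts \<open>\<beta>\<close> on \<open>x\<^sub>n\<close> and \<open>\<alpha>\<close> on \<open>x\<^sub>n\<^sub>-\<^sub>1\<close>. In \<open>jacobi\<close>, \<open>sum_list (take k es)\<close> is the total
  degree of the entries of \<open>ys\<close> preceding position \<open>k\<close>.\<close>

locale n_bihom_lie_color_algebra = graded_vector_space scale G
  for n :: nat
    and scale :: "'k::field \<Rightarrow> 'v::ab_group_add \<Rightarrow> 'v"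
    and G :: "'g::ab_group_add \<Rightarrow> 'v set" +
  fixes br :: "'v list \<Rightarrow> 'v"
    and \<epsilon> :: "'g \<Rightarrow> 'g \<Rightarrow> 'k"
    and \<alpha> \<beta> :: "'v \<Rightarrow> 'v"
  assumes arity: "n \<ge> 2"
    and bracket: "even_multilinear n scale G br"
    and bichar: "bicharacter \<epsilon>"
    and even_alpha: "even_linear scale G \<alpha>"
    and even_beta: "even_linear scale G \<beta>"
    and commute: "\<alpha> \<circ> \<beta> = \<beta> \<circ> \<alpha>"
    and skew: "\<lbrakk>length xs = n; homogeneous_list G xs ds; Suc k < n\<rbrakk> \<Longrightarrow>
      br (twist \<alpha> \<beta> xs) =
        - scale (\<epsilon> (ds ! k) (ds ! Suc k)) (br (twist \<alpha> \<beta> (xs[k := xs ! Suc k, Suc k := xs ! k])))"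
    and jacobi: "\<lbrakk>length xs = n - 1; homogeneous_list G xs ds; length ys = n; homogeneous_list G ys es\<rbrakk> \<Longrightarrow>
      br (map (\<beta> \<circ> \<beta>) xs @ [br (twist \<alpha> \<beta> ys)]) =
        (\<Sum>k<n. scale (\<epsilon> (sum_list ds) (sum_list (take k es)))
                  (br ((map (\<beta> \<circ> \<beta>) ys)[k := br (twist \<alpha> \<beta> (xs @ [ys ! k]))])))"

definition semi_morphism ::
  "nat \<Rightarrow> ('k::field \<Rightarrow> 'v::ab_group_add \<Rightarrow> 'v) \<Rightarrow> ('g \<Rightarrow> 'v set) \<Rightarrow> ('v list \<Rightarrow> 'v) \<Rightarrow>
   ('v \<Rightarrow> 'v) \<Rightarrow> ('v \<Rightarrow> 'v) \<Rightarrow> ('v \<Rightarrow> 'v) \<Rightarrow> bool" where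
  "semi_morphism n scale G br \<alpha> \<beta> \<gamma> \<longleftrightarrow>
     even_linear scale G \<gamma> \<and> \<gamma> \<circ> \<alpha> = \<alpha> \<circ> \<gamma> \<and> \<gamma> \<circ> \<beta> = \<beta> \<circ> \<gamma> \<and>
     (\<forall>xs i. length xs = n \<longrightarrow> i < n \<longrightarrow> \<gamma> (br xs) = br (xs[i := \<gamma> (xs ! i)]))"

end

theory Submission
  imports Defs
begin

text \<open>On lists of length \<open>n\<close> the new bracket is \<open>\<gamma> \<circ> br\<close>, so each axiom is the image under the even
  linear map \<open>\<gamma>\<close> (for the Jacobi identity, under \<open>\<gamma> \<circ> \<gamma>\<close>) of the axiom for \<open>br\<close>.\<close>

lemma length_twist: "xs \<noteq> [] \<Longrightarrow> length (twist \<alpha> \<beta> xs) = length xs"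
  by (simp add: twist_def)

theorem theorem3p10:
  fixes scale :: "'k::field \<Rightarrow> 'v::ab_group_add \<Rightarrow> 'v"
    and G :: "'g::ab_group_add \<Rightarrow> 'v set"
    and br :: "'v list \<Rightarrow> 'v"
    and \<epsilon> :: "'g \<Rightarrow> 'g \<Rightarrow> 'k"
    and \<alpha> \<beta> \<gamma> :: "'v \<Rightarrow> 'v"
    and n i :: nat
  assumes "CHAR('k) \<noteq> 2"
    and "n_bihom_lie_color_algebra n scale G br \<epsilon> \<alpha> \<beta>"
    and "semi_morphism n scale G br \<alpha> \<beta> \<gamma>"
    and "i < n"
  shows "n_bihom_lie_color_algebra n scale G (\<lambda>xs. br (xs[i := \<gamma> (xs ! i)])) \<epsilon> \<alpha> \<beta>"
proof -
  interpret n_bihom_lie_color_algebra n scale G br \<epsilon> \<alpha> \<beta>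
    by fact
  have even: "\<And>d x. x \<in> G d \<Longrightarrow> \<gamma> x \<in> G d"
    and semi: "\<And>xs j. length xs = n \<Longrightarrow> j < n \<Longrightarrow> br (xs[j := \<gamma> (xs ! j)]) = \<gamma> (br xs)"
    using assms(3) by (auto simp: semi_morphism_def even_linear_def)
  have lin: "Vector_Spaces.linear scale scale \<gamma>"
    using assms(3) by (simp add: semi_morphism_def even_linear_def)
  interpret \<gamma>: Vector_Spaces.linear scale scale \<gamma>
    by (fact lin)
  \<comment> \<open>Taking \<open>semi\<close> at a list that already carries \<open>v\<close> in
    slot \<open>j\<close> makes the old entry irrelevant, so a \<open>\<gamma>\<close> in front of
    any argument can be pulled out of the bracket.\<close>
  have semi_update: "br (xs[j := \<gamma> v]) = \<gamma> (br (xs[j := v]))"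
    if "length xs = n" "j < n" for xs j v
    using semi[of "xs[j := v]" j] that by simp
  have new: "br (xs[i := \<gamma> (xs ! i)]) = \<gamma> (br xs)" if "length xs = n" for xs
    using semi that assms(4) by blast
  \<comment> \<open>By \<open>arity\<close> the list is nonempty; the twist of the empty list would
    have length 1. Thus \<open>new\<close> applies to twisted lists.\<close>
  have len: "length (twist \<alpha> \<beta> xs) = n" if "length xs = n" for xs
    using that arity by (subst length_twist) auto
  show ?thesis
  proof unfold_locales
    show "n \<ge> 2" "bicharacter \<epsilon>" "even_linear scale G \<alpha>" "even_linear scale G \<beta>" "\<alpha> \<circ> \<beta> = \<beta> \<circ> \<alpha>"
      by (fact arity bichar even_alpha even_beta commute)+
  next
    have "Vector_Spaces.linear scale scale (\<lambda>v. \<gamma> (br (xs[j := v])))"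
      if "length xs = n" "j < n" for xs j
      using bracket that Vector_Spaces.linear_compose[OF _ lin, of scale "\<lambda>v. br (xs[j := v])"]
      by (simp add: even_multilinear_def comp_def)
    moreover have "\<gamma> (br xs) \<in> G (sum_list ds)"
      if "length xs = n" "homogeneous_list G xs ds" for xs ds
      using bracket that even by (simp add: even_multilinear_def)
    \<comment> \<open>The equation \<open>new\<close> is conditional on the length;
      \<open>imp_cong\<close> makes the premise \<open>length xs = n\<close> available while the
      conclusion is rewritten.\<close>
    ultimately show "even_multilinear n scale G (\<lambda>xs. br (xs[i := \<gamma> (xs ! i)]))"
      by (simp only: even_multilinear_def new length_list_update simp_thms cong: imp_cong)
  next
    fix xs ds k
    assume "length xs = n" "homogeneous_list G xs ds" "Suc k < n"
    then show "br ((twist \<alpha> \<beta> xs)[i := \<gamma> (twist \<alpha> \<beta> xs ! i)]) =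
        - scale (\<epsilon> (ds ! k) (ds ! Suc k))
          (br ((twist \<alpha> \<beta> (xs[k := xs ! Suc k, Suc k := xs ! k]))
            [i := \<gamma> (twist \<alpha> \<beta> (xs[k := xs ! Suc k, Suc k := xs ! k]) ! i)]))"
      \<comment> \<open>Both brackets become \<open>\<gamma>\<close> of the old ones, and linearity
        moves the sign and the scalar through \<open>\<gamma>\<close>.\<close>
      using arg_cong[OF skew, of xs ds k \<gamma>] by (simp add: new len \<gamma>.neg \<gamma>.scale)
  next
    fix xs ds ys es
    assume H: "length xs = n - 1" "homogeneous_list G xs ds" "length ys = n" "homogeneous_list G ys es"
    let ?new = "\<lambda>xs. br (xs[i := \<gamma> (xs ! i)])"
    let ?X = "map (\<beta> \<circ> \<beta>) xs" and ?Y = "map (\<beta> \<circ> \<beta>) ys"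
    let ?c = "\<lambda>k. \<epsilon> (sum_list ds) (sum_list (take k es))"
    have "?new (?X @ [?new (twist \<alpha> \<beta> ys)]) = \<gamma> (br (?X @ [\<gamma> (br (twist \<alpha> \<beta> ys))]))"
      using H arity by (simp add: new len)
    also have "\<dots> = \<gamma> (\<gamma> (br (?X @ [br (twist \<alpha> \<beta> ys)])))"
      \<comment> \<open>\<open>?X\<close> has length \<open>n - 1\<close>, so slot
        \<open>n - 1\<close> is the last one; \<open>undefined\<close> only fills it and is
        overwritten on both sides.\<close>
      using semi_update[of "?X @ [undefined]" "n - 1"] H arity by (simp add: list_update_append)
    also have "\<dots> = (\<Sum>k<n. scale (?c k) (\<gamma> (\<gamma> (br (?Y[k := br (twist \<alpha> \<beta> (xs @ [ys ! k]))])))))"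
      by (simp only: jacobi[OF H] \<gamma>.sum \<gamma>.scale)
    also have "\<dots> = (\<Sum>k<n. scale (?c k) (?new (?Y[k := ?new (twist \<alpha> \<beta> (xs @ [ys ! k]))])))"
      \<comment> \<open>In the summand \<open>k\<close> the inner bracket sits in slot
        \<open>k\<close>, so \<open>semi_update\<close> at that slot brings out its
        \<open>\<gamma>\<close>, while \<open>new\<close> gives the outer one.\<close>
      using H arity by (intro sum.cong refl) (simp add: new len semi_update)
    finally show "?new (?X @ [?new (twist \<alpha> \<beta> ys)]) = \<dots>" .
  qed
qed

end
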